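(* Let $\mathcal{A} = \{A_1, A_2, \ldots, A_m\}$ be linearly independent in $\mathcal{D}_n$, where $A_k = ((a_{11}^k, a_{22}^k, \ldots, a_{nn}^k))$ for each $1 \le k \le m$. Suppose that the $j_1$-th, $j_2$-th, $\ldots$, $j_r$-th components form a complete list of pairwise nonequivalent components satisfying the $*$-Property (that is, each satisfies the $*$-Property, they are pairwise nonequivalent, and every component satisfying the $*$-Property is equivalent to one of them). Then given any $T \in \mathcal{M}_n$ and $\alpha_1, \ldots, \alpha_m \in \mathbb{R}$, the matrix $\sum_{k=1}^m \alpha_k A_k$ is a best coapproximation to $T$ out of $\mathrm{span}\{A_1, A_2, \ldots, A_m\}$ if and only if $$a_{j_p j_p}^1 \alpha_1 + a_{j_p j_p}^2 \alpha_2 + \cdots + a_{j_p j_p}^m \alpha_m \in W\big({}^{j_p}T_*\big) \quad \text{for all } p \in \{1, 2, \ldots, r\},$$ where $W({}^{j_p}T_* )$ is the numerical range of the $*$-associated matrix of $T$ corresponding to the $j_p$-th component.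
   Context: $\mathcal{M}_n$ is the space of $n \times n$ real matrices with the operator norm induced by the Euclidean norm $\|\cdot\|_2$ on $\mathbb{R}^n$, and $\mathcal{D}_n \subset \mathcal{M}_n$ is the subspace of diagonal matrices; $((a_{11}, \ldots, a_{nn}))$ denotes the diagonal matrix with these diagonal entries. For a subspace $\mathbb{Y}$ of a Banach space $\mathbb{X}$ and $x \in \mathbb{X}$, $y_0 \in \mathbb{Y}$ is a best coapproximation to $x$ out of $\mathbb{Y}$ if $\|y_0 - y\| \le \|x - y\|$ for all $y \in \mathbb{Y}$. For $\mathcal{A} = \{A_1, \ldots, A_m\}$ linearly independent in $\mathcal{D}_n$ as in the claim and $i \in \{1, \ldots, n\}$: the $i$-th component (of $\mathcal{A}$) is the vector $(a_{ii}^1, a_{ii}^2, \ldots, a_{ii}^m) \in \mathbb{R}^m$. The $i$-th and $j$-th components are equivalent if $(a_{ii}^1, \ldots, a_{ii}^m) = \pm (a_{jj}^1, \ldots, a_{jj}^m)$, and nonequivalent otherwise. Put $P_i^+ = \{j \in \{1,\ldots,n\} : (a_{jj}^1, \ldots, a_{jj}^m) = (a_{ii}^1, \ldots, a_{ii}^m)\}$ and $P_i^- = \{j \in \{1,\ldots,n\} : (a_{jj}^1, \ldots, a_{jj}^m) = -(a_{ii}^1, \ldots, a_{ii}^m)\}$. The $i$-th component satisfies the $*$-Property if there exist $\beta_1, \ldots, \beta_m \in \mathbb{R}$ such that $|\sum_{k=1}^m \beta_k a_{ii}^k| > \max\{|\sum_{k=1}^m \beta_k a_{jj}^k| : 1 \le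 j \le n,\ j \notin P_i^+ \cup P_i^-\}$ (if no such $j$ exists, the condition is regarded as satisfied). If the $i$-th component satisfies the $*$-Property and $T = (b_{pq})_{1 \le p,q \le n} \in \mathcal{M}_n$, the $*$-associated matrix of $T$ corresponding to the $i$-th component is the square matrix ${}^iT_* = (c_{rs})$ of order $k_i = |P_i^+ \cup P_i^-|$, with rows and columns indexed by $r, s \in P_i^+ \cup P_i^-$, given by $c_{rs} = b_{rs}$ if $r \in P_i^+$ and $c_{rs} = -b_{rs}$ if $r \in P_i^-$. The numerical range of a real $k \times k$ matrix $S$ is $W(S) = \{\langle Sx, x\rangle : x \in \mathbb{R}^k,\ \|x\|_2 = 1\}$. *)

theory Defs
  imports "HOL-Analysis.Analysis"
begin

(* The type class norm on real^'n^'n is the Euclidean norm of the matrix entries, so the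
   operator norm is introduced separately. *)
definition matrix_opnorm :: "real^'n^'n \<Rightarrow> real" where
  "matrix_opnorm A = onorm ((*v) A)"

(* N is the norm of the ambient space. *)
definition best_coapproximation ::
    "('a::real_vector \<Rightarrow> real) \<Rightarrow> 'a set \<Rightarrow> 'a \<Rightarrow> 'a \<Rightarrow> bool" where
  "best_coapproximation N Y x y0 \<longleftrightarrow> y0 \<in> Y \<and> (\<forall>y\<in>Y. N (y0 - y) \<le> N (x - y))"

definition diagonal_matrices :: "(real^'n^'n) set" where
  "diagonal_matrices = {A. \<forall>i j. i \<noteq> j \<longrightarrow> A $ i $ j = 0}"

definition linearly_independent_family :: "('m \<Rightarrow> 'a::real_vector) \<Rightarrow> bool" where
  "linearly_independent_family A \<longleftrightarrow> inj A \<and> independent (range A)"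

(* A family A_1, ..., A_m is indexed by a finite type 'm with CARD('m) = m; in particular
   m \<ge> 1. *)
definition component :: "('m::finite \<Rightarrow> real^'n^'n) \<Rightarrow> 'n \<Rightarrow> real^'m" where
  "component A i = (\<chi> k. A k $ i $ i)"

definition equivalent_components :: "('m::finite \<Rightarrow> real^'n^'n) \<Rightarrow> 'n \<Rightarrow> 'n \<Rightarrow> bool" where
  "equivalent_components A i j \<longleftrightarrow>
     component A i = component A j \<or> component A i = - component A j"

definition P_plus :: "('m::finite \<Rightarrow> real^'n^'n) \<Rightarrow> 'n \<Rightarrow> 'n set" where
  "P_plus A i = {j. component A j = component A i}"

definition P_minus :: "('m::finite \<Rightarrow> real^'n^'n) \<Rightarrow> 'n \<Rightarrow> 'n set" where
  "P_minus A i = {j. component A j = - component A i}"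

definition star_property :: "('m::finite \<Rightarrow> real^'n^'n) \<Rightarrow> 'n \<Rightarrow> bool" where
  "star_property A i \<longleftrightarrow>
     (\<exists>\<beta> :: real^'m.
        let J = - (P_plus A i \<union> P_minus A i) in
          J = {} \<or>
          \<bar>\<Sum>k\<in>UNIV. \<beta> $ k * component A i $ k\<bar>
            > Max ((\<lambda>j. \<bar>\<Sum>k\<in>UNIV. \<beta> $ k * component A j $ k\<bar>) ` J))"

(* A square matrix whose rows and columns are indexed by a finite set I is represented by
   a function of the two indices, of which only the values on I \<times> I matter. *)
definition star_index :: "('m::finite \<Rightarrow> real^'n^'n) \<Rightarrow> 'n \<Rightarrow> 'n set" where
  "star_index A i = P_plus A i \<union> P_minus A i"

definition star_associated ::
    "('m::finite \<Rightarrow> real^'n^'n) \<Rightarrow> real^'n^'n \<Rightarrow> 'n \<Rightarrow> 'n \<Rightarrow> 'n \<Rightarrow> real" where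
  "star_associated A T i r s = (if r \<in> P_plus A i then T $ r $ s else - T $ r $ s)"

definition numerical_range :: "'i set \<Rightarrow> ('i \<Rightarrow> 'i \<Rightarrow> real) \<Rightarrow> real set" where
  "numerical_range I S =
     {\<Sum>r\<in>I. (\<Sum>s\<in>I. S r s * x s) * x r | x. L2_set x I = 1}"

end

theory Submission imports Defs begin

text \<open>
Write \<open>c i\<close> for the component of index \<open>i\<close> and \<open>D \<beta>\<close> for the combination
\<open>\<Sum>k. \<beta> k A k\<close>, which is the diagonal matrix with entries \<open>\<beta> \<bullet> c i\<close>.  Since the span
is a subspace, \<open>D \<alpha>\<close> is a best coapproximation to \<open>T\<close> exactly when the residual
\<open>S = T - D \<alpha>\<close> satisfies \<open>\<parallel>D \<gamma>\<parallel> \<le> \<parallel>S + D \<gamma>\<parallel>\<close> for all \<open>\<gamma>\<close>, that is, when the span is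
Birkhoff-James orthogonal to \<open>S\<close>.

For \<open>x\<close> supported on the class \<open>P_plus A i \<union> P_minus A i\<close>, let \<open>y\<close> be \<open>x\<close> with the signs of the
coordinates outside \<open>P_plus A i\<close> reversed.  Then \<open>D \<beta> x = (\<beta> \<bullet> c i) y\<close>, and the numerical
range of the star-associated matrix consists of the numbers \<open>T x \<bullet> y\<close> for such unit vectors
\<open>x\<close>.  So \<open>\<alpha> \<bullet> c i\<close> lies in this range exactly when \<open>S x \<bullet> y = 0\<close> for one of them.

If this holds for representatives of all components with the star property, let \<open>\<gamma>\<close> be given.
The norm of \<open>D \<gamma>\<close> is the maximum of \<open>\<bar>\<gamma> \<bullet> c i\<bar>\<close>, and this maximum is attained at a component
with the star property (\<open>star_property_attains_max\<close>: geometrically, the star components and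
their negatives are the vertices of the convex hull of all \<open>\<plusminus> c i\<close>, and a linear functional is
maximal at a vertex).  The corresponding \<open>x\<close> and \<open>y\<close> are unit vectors with
\<open>(S + D \<gamma>) x \<bullet> y = \<gamma> \<bullet> c i\<close>, which bounds the norm of \<open>S + D \<gamma>\<close> from below.

Conversely, let \<open>\<beta>\<close> be a functional that peaks exactly on the class of \<open>i\<close>.  Orthogonality along
the rays spanned by \<open>D \<beta>\<close> and \<open>D (- \<beta>)\<close> yields, by a one-sided Bhatia-Semrl theorem
(\<open>onorm_ray_orthogonal_imp_inner_nonneg\<close>), unit vectors at which \<open>D \<beta>\<close> attains its norm and
\<open>S x \<bullet> D \<beta> x\<close> is nonnegative, respectively nonpositive.  Attaining the norm forces the support
into the class of \<open>i\<close>, so \<open>S x \<bullet> y\<close> takes both signs, and the intermediate value theorem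
supplies a zero.
\<close>

section \<open>Operators on Euclidean space\<close>

text \<open>The unit sphere is compact, so the supremum in the operator norm is attained.\<close>

lemma onorm_attained:
  fixes f :: "'a::euclidean_space \<Rightarrow> 'b::real_normed_vector"
  assumes "bounded_linear f"
  obtains x where "norm x = 1" "norm (f x) = onorm f"
proof -
  interpret bounded_linear f by fact
  have "continuous_on (sphere 0 1) (\<lambda>x. norm (f x))"
    by (intro continuous_intros continuous_on)
  then obtain x where x: "x \<in> sphere 0 1" "\<And>y. y \<in> sphere 0 1 \<Longrightarrow> norm (f y) \<le> norm (f x)"
    using continuous_attains_sup[of "sphere (0::'a) 1" "\<lambda>x. norm (f x)"] by auto
  have "norm (f y) \<le> norm (f x) * norm y" for y
  proof (cases "y = 0")
    case False
    have "norm (f (y /\<^sub>R norm y)) \<le> norm (f x)"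
      using False by (intro x(2)) auto
    with False show ?thesis by (simp add: scaleR field_simps)
  qed (simp add: zero)
  then have "onorm f \<le> norm (f x)"
    by (intro onorm_bound) auto
  moreover have "norm (f x) \<le> onorm f"
    using onorm[OF assms, of x] x(1) by simp
  ultimately show ?thesis using that x(1) by (auto intro: antisym)
qed

text \<open>A one-sided form of the Bhatia-Semrl characterization of Birkhoff-James orthogonality.
A unit vector \<open>x\<close> at which \<open>S + k B\<close> attains its norm satisfies
\<open>(norm (S x))\<^sup>2 + 2 k (S x \<bullet> B x) + k\<^sup>2 (norm (B x))\<^sup>2 \<ge> k\<^sup>2 (onorm B)\<^sup>2\<close>.  Since
\<open>norm (B x) \<le> onorm B\<close>, the sum of the first two terms is nonnegative, so \<open>S x \<bullet> B x\<close> is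
bounded below by a quantity of order \<open>- 1 / k\<close>; dividing by \<open>k\<^sup>2\<close> instead shows that
\<open>(norm (B x))\<^sup>2\<close> falls short of \<open>(onorm B)\<^sup>2\<close> by a quantity of order \<open>1 / k\<close> at most.  A limit
point of these vectors as \<open>k\<close> tends to infinity has both required properties.\<close>

lemma onorm_ray_orthogonal_imp_inner_nonneg:
  fixes S B :: "'a::euclidean_space \<Rightarrow> 'b::real_inner"
  assumes S: "bounded_linear S" and B: "bounded_linear B"
    and le: "\<And>k. k > 0 \<Longrightarrow> k * onorm B \<le> onorm (\<lambda>x. S x + k *\<^sub>R B x)"
  obtains x where "norm x = 1" "norm (B x) = onorm B" "S x \<bullet> B x \<ge> 0"
proof -
  let ?M = "onorm S" and ?N = "onorm B"
  have bound: "norm (S x) \<le> ?M" "norm (B x) \<le> ?N" if "norm x = 1" for x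
    using onorm[OF S, of x] onorm[OF B, of x] that by simp_all
  have pos: "0 \<le> ?M" "0 \<le> ?N" using S B by (simp_all add: onorm_pos_le)
  have "\<exists>x. norm x = 1 \<and> - ?M\<^sup>2 \<le> 2 * real (Suc n) * (S x \<bullet> B x) \<and>
          ?N\<^sup>2 - (?M\<^sup>2 + 2 * ?M * ?N) / real (Suc n) \<le> (norm (B x))\<^sup>2" for n
  proof -
    let ?k = "real (Suc n)"
    have "bounded_linear (\<lambda>x. S x + ?k *\<^sub>R B x)"
      using S B by (intro bounded_linear_add bounded_linear_const_scaleR)
    then obtain x where x: "norm x = 1"
      "norm (S x + ?k *\<^sub>R B x) = onorm (\<lambda>x. S x + ?k *\<^sub>R B x)"
      using onorm_attained by blast
    have "?k * ?N \<le> norm (S x + ?k *\<^sub>R B x)"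
      unfolding x(2) by (rule le) simp
    then have "(?k * ?N)\<^sup>2 \<le> (norm (S x + ?k *\<^sub>R B x))\<^sup>2"
      using pos by (intro power_mono) auto
    also have "\<dots> = (norm (S x))\<^sup>2 + 2 * ?k * (S x \<bullet> B x) + ?k\<^sup>2 * (norm (B x))\<^sup>2"
      unfolding power2_norm_eq_inner
      by (simp add: inner_add_left inner_add_right inner_commute power2_eq_square algebra_simps
               del: of_nat_Suc)
    finally have *: "?k\<^sup>2 * ?N\<^sup>2 \<le> (norm (S x))\<^sup>2 + 2 * ?k * (S x \<bullet> B x) + ?k\<^sup>2 * (norm (B x))\<^sup>2"
      by (simp add: power_mult_distrib)
    have Sx: "(norm (S x))\<^sup>2 \<le> ?M\<^sup>2" and Bx: "(norm (B x))\<^sup>2 \<le> ?N\<^sup>2"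
      using bound[OF x(1)] by (auto intro: power_mono)
    have 1: "- ?M\<^sup>2 \<le> 2 * ?k * (S x \<bullet> B x)"
      using * Sx mult_left_mono[OF Bx zero_le_power2[of ?k]] by linarith
    have "S x \<bullet> B x \<le> norm (S x) * norm (B x)"
      by (rule norm_cauchy_schwarz)
    also have "\<dots> \<le> ?M * ?N"
      using bound[OF x(1)] pos by (intro mult_mono) auto
    finally have inner: "S x \<bullet> B x \<le> ?M * ?N" .
    have "?M\<^sup>2 \<le> ?k * ?M\<^sup>2"
      by (simp add: algebra_simps)
    moreover have "2 * ?k * (S x \<bullet> B x) \<le> 2 * ?k * (?M * ?N)"
      using inner by (intro mult_left_mono) auto
    ultimately have "?k\<^sup>2 * ?N\<^sup>2 \<le> ?k * ?M\<^sup>2 + 2 * ?k * (?M * ?N) + ?k\<^sup>2 * (norm (B x))\<^sup>2"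
      using * Sx by linarith
    then have "?k * (?k * ?N\<^sup>2) \<le> ?k * (?M\<^sup>2 + 2 * ?M * ?N + ?k * (norm (B x))\<^sup>2)"
      by (simp add: power2_eq_square algebra_simps del: of_nat_Suc)
    then have "?k * ?N\<^sup>2 \<le> ?M\<^sup>2 + 2 * ?M * ?N + ?k * (norm (B x))\<^sup>2"
      by (rule mult_left_le_imp_le) simp
    then have 2: "?N\<^sup>2 - (?M\<^sup>2 + 2 * ?M * ?N) / ?k \<le> (norm (B x))\<^sup>2"
      by (simp add: field_simps del: of_nat_Suc)
    show ?thesis using x(1) 1 2 by blast
  qed
  then obtain u where u: "\<And>n. norm (u n) = 1"
      "\<And>n. - ?M\<^sup>2 \<le> 2 * real (Suc n) * (S (u n) \<bullet> B (u n))"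
      "\<And>n. ?N\<^sup>2 - (?M\<^sup>2 + 2 * ?M * ?N) / real (Suc n) \<le> (norm (B (u n)))\<^sup>2"
    by metis
  have "\<forall>n. u n \<in> sphere 0 1" using u(1) by simp
  then obtain x h where x: "x \<in> sphere 0 1" and h: "strict_mono h" and lim: "(u \<circ> h) \<longlonglongrightarrow> x"
    using compact_sphere[of "0::'a" 1] unfolding compact_def by blast
  have SL: "(\<lambda>n. S (u (h n))) \<longlonglongrightarrow> S x" and BL: "(\<lambda>n. B (u (h n))) \<longlonglongrightarrow> B x"
    using bounded_linear.tendsto[OF S lim] bounded_linear.tendsto[OF B lim] by (simp_all add: o_def)
  have small: "(\<lambda>n. c / real (Suc (h n))) \<longlonglongrightarrow> 0" for c :: real
  proof -
    have "(\<lambda>n. c / real (Suc n)) \<longlonglongrightarrow> 0"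
      using LIMSEQ_Suc[OF lim_const_over_n[of c]] by simp
    from LIMSEQ_subseq_LIMSEQ[OF this h] show ?thesis by (simp add: o_def)
  qed
  have "0 \<le> S x \<bullet> B x"
  proof (rule LIMSEQ_le[OF small[of "- ?M\<^sup>2 / 2"] tendsto_inner[OF SL BL]])
    show "\<exists>N. \<forall>n\<ge>N. - ?M\<^sup>2 / 2 / real (Suc (h n)) \<le> S (u (h n)) \<bullet> B (u (h n))"
    proof (intro exI allI impI)
      fix n
      show "- ?M\<^sup>2 / 2 / real (Suc (h n)) \<le> S (u (h n)) \<bullet> B (u (h n))"
        using u(2)[of "h n"]
        by (subst pos_divide_le_eq) (simp_all add: mult_ac del: of_nat_Suc)
    qed
  qed
  moreover have "?N\<^sup>2 \<le> (norm (B x))\<^sup>2"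
  proof (rule LIMSEQ_le)
    show "(\<lambda>n. ?N\<^sup>2 - (?M\<^sup>2 + 2 * ?M * ?N) / real (Suc (h n))) \<longlonglongrightarrow> ?N\<^sup>2"
      using tendsto_diff[OF tendsto_const small, of "?N\<^sup>2"] by simp
    show "(\<lambda>n. (norm (B (u (h n))))\<^sup>2) \<longlonglongrightarrow> (norm (B x))\<^sup>2"
      by (intro tendsto_intros BL)
    show "\<exists>N. \<forall>n\<ge>N. ?N\<^sup>2 - (?M\<^sup>2 + 2 * ?M * ?N) / real (Suc (h n)) \<le> (norm (B (u (h n))))\<^sup>2"
      using u(3) by blast
  qed
  then have "?N \<le> norm (B x)" by (rule power2_le_imp_le) simp
  ultimately show ?thesis using that[of x] x bound(2)[of x] by (auto intro: antisym)
qed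

text \<open>Real numerical ranges are intervals.  A segment between unit vectors \<open>x \<noteq> - y\<close> avoids the
origin, so a zero of the form on it can be normalized; if \<open>x = - y\<close>, evenness of the form makes
both values vanish.\<close>

lemma quadratic_form_zero_between:
  fixes f g :: "'a::real_normed_vector \<Rightarrow> 'b::real_inner"
  assumes f: "bounded_linear f" and g: "bounded_linear g" and V: "subspace V"
    and x: "x \<in> V" "norm x = 1" "f x \<bullet> g x \<ge> 0"
    and y: "y \<in> V" "norm y = 1" "f y \<bullet> g y \<le> 0"
  obtains z where "z \<in> V" "norm z = 1" "f z \<bullet> g z = 0"
proof (cases "x = - y")
  case True
  then have "f x \<bullet> g x = f y \<bullet> g y"
    using f g by (simp add: bounded_linear.linear linear_neg)
  with x y that show ?thesis by auto
next
  case False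
  define w where "w t = (1 - t) *\<^sub>R x + t *\<^sub>R y" for t :: real
  have "continuous_on {0..1} (\<lambda>t. f (w t) \<bullet> g (w t))"
    unfolding w_def
    by (intro continuous_intros bounded_linear.continuous_on[OF f] bounded_linear.continuous_on[OF g])
  then obtain t where t: "0 \<le> t" "t \<le> 1" "f (w t) \<bullet> g (w t) = 0"
    using IVT2'[of "\<lambda>t. f (w t) \<bullet> g (w t)" 1 0 0] x y by (auto simp: w_def)
  have "w t \<noteq> 0"
  proof
    assume "w t = 0"
    then have eq: "(1 - t) *\<^sub>R x = - (t *\<^sub>R y)"
      by (simp add: w_def eq_neg_iff_add_eq_0)
    then have "norm ((1 - t) *\<^sub>R x) = norm (t *\<^sub>R y)" by simp
    then have "t = 1 / 2" using t x y by simp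
    with eq have "(1 / 2 :: real) *\<^sub>R x = (1 / 2) *\<^sub>R (- y)" by simp
    with False show False by (simp only: scaleR_cancel_left) simp
  qed
  moreover have "w t \<in> V" unfolding w_def
    using V x y by (intro subspace_add subspace_scale)
  ultimately show ?thesis
    using t(3) V f g
    by (intro that[of "w t /\<^sub>R norm (w t)"])
       (simp_all add: subspace_scale bounded_linear.linear linear_scale)
qed

lemma matrix_opnorm_ge_inner:
  fixes M :: "real^'n^'n"
  assumes "norm x = 1" "norm y = 1"
  shows "\<bar>(M *v x) \<bullet> y\<bar> \<le> matrix_opnorm M"
proof -
  have "\<bar>(M *v x) \<bullet> y\<bar> \<le> norm (M *v x) * norm y"
    by (rule Cauchy_Schwarz_ineq2)
  also have "\<dots> \<le> matrix_opnorm M"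
    using onorm[OF matrix_vector_mul_bounded_linear[of M], of x] assms
    by (simp add: matrix_opnorm_def)
  finally show ?thesis .
qed

section \<open>Combinations of diagonal matrices\<close>

definition combination :: "('m::finite \<Rightarrow> real^'n^'n) \<Rightarrow> real^'m \<Rightarrow> real^'n^'n" where
  "combination A \<beta> = (\<Sum>k\<in>UNIV. \<beta> $ k *\<^sub>R A k)"

lemma linear_combination: "linear (combination A)"
  by (rule linearI)
     (simp_all add: combination_def scaleR_add_left sum.distrib scaleR_sum_right)

lemma span_range_eq_range_combination: "span (range A) = range (combination A)"
proof
  have "A k \<in> range (combination A)" for k
  proof -
    have "combination A (axis k 1) = (\<Sum>l\<in>UNIV. if l = k then A l else 0)"
      unfolding combination_def by (rule sum.cong) (auto simp: axis_def)
    then have "A k = combination A (axis k 1)" by simp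
    then show ?thesis by blast
  qed
  then show "span (range A) \<subseteq> range (combination A)"
    by (intro span_minimal linear_subspace_image linear_combination) auto
  show "range (combination A) \<subseteq> span (range A)"
    by (auto simp: combination_def intro!: span_sum span_scale intro: span_base)
qed

text \<open>Because the candidate lies in the subspace, the subspace can be translated by it: the
condition becomes Birkhoff-James orthogonality to the residual.\<close>

lemma best_coapproximation_combination_iff:
  "best_coapproximation N (span (range A)) T (combination A \<alpha>) \<longleftrightarrow>
    (\<forall>\<gamma>. N (combination A \<gamma>) \<le> N (T - combination A \<alpha> + combination A \<gamma>))"
proof -
  have "(\<forall>\<beta>. N (combination A \<alpha> - combination A \<beta>) \<le> N (T - combination A \<beta>)) \<longleftrightarrow>
    (\<forall>\<gamma>. N (combination A \<gamma>) \<le> N (T - combination A \<alpha> + combination A \<gamma>))" (is "?L \<longleftrightarrow> ?R")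
  proof
    assume L: ?L
    show ?R
    proof
      fix \<gamma>
      show "N (combination A \<gamma>) \<le> N (T - combination A \<alpha> + combination A \<gamma>)"
        using L[rule_format, of "\<alpha> - \<gamma>"]
        by (simp add: linear_diff[OF linear_combination] algebra_simps)
    qed
  next
    assume R: ?R
    show ?L
    proof
      fix \<beta>
      show "N (combination A \<alpha> - combination A \<beta>) \<le> N (T - combination A \<beta>)"
        using R[rule_format, of "\<alpha> - \<beta>"]
        by (simp add: linear_diff[OF linear_combination] algebra_simps)
    qed
  qed
  then show ?thesis
    by (auto simp: best_coapproximation_def span_range_eq_range_combination)
qed

lemma combination_mult_vec_nth:
  fixes A :: "'m::finite \<Rightarrow> real^'n^'n"
  assumes "\<And>k. A k \<in> diagonal_matrices"
  shows "(combination A \<beta> *v x) $ i = (\<beta> \<bullet> component A i) * x $ i"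
proof -
  have "combination A \<beta> $ i $ l = (if l = i then \<beta> \<bullet> component A i else 0)" for l
    using assms
    by (auto simp: combination_def component_def inner_vec_def diagonal_matrices_def)
  then have "(combination A \<beta> *v x) $ i =
      (\<Sum>l\<in>UNIV. if l = i then (\<beta> \<bullet> component A i) * x $ l else 0)"
    unfolding matrix_vector_mult_def by (simp add: if_distrib[of "\<lambda>c. c * _"] cong: if_cong)
  then show ?thesis by simp
qed

lemma matrix_opnorm_combination_le:
  fixes A :: "'m::finite \<Rightarrow> real^'n^'n"
  assumes "\<And>k. A k \<in> diagonal_matrices" and b: "\<And>i. \<bar>\<beta> \<bullet> component A i\<bar> \<le> b"
  shows "matrix_opnorm (combination A \<beta>) \<le> b"
proof -
  have b0: "0 \<le> b" using b[of undefined] by linarith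
  have "norm (combination A \<beta> *v x) \<le> b * norm x" for x
  proof -
    have "norm (combination A \<beta> *v x) \<le> norm (b *\<^sub>R x)"
      using b b0
      by (intro norm_le_componentwise_cart)
         (auto simp: combination_mult_vec_nth[OF assms(1)] abs_mult intro!: mult_right_mono)
    then show ?thesis using b0 by simp
  qed
  with b0 show ?thesis unfolding matrix_opnorm_def by (intro onorm_bound)
qed

lemma matrix_opnorm_combination_ge:
  fixes A :: "'m::finite \<Rightarrow> real^'n^'n"
  assumes "\<And>k. A k \<in> diagonal_matrices"
  shows "\<bar>\<beta> \<bullet> component A i\<bar> \<le> matrix_opnorm (combination A \<beta>)"
  using matrix_opnorm_ge_inner[of "axis i 1" "axis i 1" "combination A \<beta>"]
  by (simp add: inner_axis combination_mult_vec_nth[OF assms] norm_axis_1)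

lemma independent_imp_component_nonzero:
  fixes A :: "'m::finite \<Rightarrow> real^'n^'n"
  assumes "\<And>k. A k \<in> diagonal_matrices" and "linearly_independent_family A"
  obtains i where "component A i \<noteq> 0"
proof (rule ccontr)
  assume "\<not> thesis"
  with that have "component A i = 0" for i by blast
  then have "A k $ i $ i = 0" for k i by (simp add: component_def vec_eq_iff)
  then have "A k $ i $ l = 0" for k i l
    using assms(1)[of k] by (cases "i = l") (auto simp: diagonal_matrices_def)
  then have "A k = 0" for k by (simp add: vec_eq_iff)
  then have "0 \<in> range A" by (metis rangeI)
  then show False
    using assms(2) dependent_zero by (auto simp: linearly_independent_family_def)
qed

section \<open>Components with the star property\<close>

lemma star_index_iff:
  "l \<in> star_index A i \<longleftrightarrow> component A l = component A i \<or> component A l = - component A i"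
  by (auto simp: star_index_def P_plus_def P_minus_def)

lemma star_property_iff_peak:
  fixes A :: "'m::finite \<Rightarrow> real^'n^'n"
  shows "star_property A i \<longleftrightarrow>
    (\<exists>\<beta>. \<forall>l. l \<notin> star_index A i \<longrightarrow> \<bar>\<beta> \<bullet> component A l\<bar> < \<bar>\<beta> \<bullet> component A i\<bar>)"
proof -
  have "(J = {} \<or> b > Max (h ` J)) \<longleftrightarrow> (\<forall>l. l \<in> J \<longrightarrow> h l < b)"
    for J :: "'n set" and b :: real and h
    by (cases "J = {}") auto
  then show ?thesis
    by (simp add: star_property_def star_index_def Let_def inner_vec_def)
qed

text \<open>If all components are equivalent, then the star property holds with \<open>\<beta> = 0\<close>; then
independence supplies a functional that does not vanish at the component.\<close>

lemma star_property_nonzero_peak: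
  fixes A :: "'m::finite \<Rightarrow> real^'n^'n"
  assumes "\<And>k. A k \<in> diagonal_matrices" "linearly_independent_family A" "star_property A i"
  obtains \<beta> where "\<beta> \<bullet> component A i \<noteq> 0"
    "\<And>l. l \<notin> star_index A i \<Longrightarrow> \<bar>\<beta> \<bullet> component A l\<bar> < \<bar>\<beta> \<bullet> component A i\<bar>"
proof (cases "star_index A i = UNIV")
  case True
  obtain l where "component A l \<noteq> 0"
    using independent_imp_component_nonzero[OF assms(1,2)] by blast
  moreover have "l \<in> star_index A i" using True by simp
  ultimately have "component A i \<noteq> 0" by (auto simp: star_index_iff)
  with True that[of "component A i"] show ?thesis by simp
next
  case False
  then obtain l where "l \<notin> star_index A i" by blast
  with assms(3) that show ?thesis unfolding star_property_iff_peak
    by (metis abs_ge_zero abs_zero order_less_irrefl order_le_less_trans)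
qed

text \<open>The functional \<open>\<gamma>\<close> may attain its maximum at several nonequivalent components.  Among
them, a component \<open>c\<close> of largest Euclidean norm has the star property: in the direction
\<open>K \<gamma> + c\<close> with \<open>K\<close> large, the components at which \<open>\<gamma>\<close> is not maximal lose by the first summand,
and the others lose by the second, because \<open>c \<bullet> d < c \<bullet> c\<close> whenever \<open>d \<noteq> c\<close> and
\<open>norm d \<le> norm c\<close>.\<close>

lemma star_property_attains_max:
  fixes A :: "'m::finite \<Rightarrow> real^'n^'n"
  assumes nonzero: "\<gamma> \<bullet> component A l \<noteq> 0"
  obtains i where "star_property A i" "\<And>l. \<bar>\<gamma> \<bullet> component A l\<bar> \<le> \<bar>\<gamma> \<bullet> component A i\<bar>"
proof -
  let ?f = "\<lambda>l. \<bar>\<gamma> \<bullet> component A l\<bar>"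
  define N where "N = Max (range ?f)"
  have fN: "?f l \<le> N" for l by (simp add: N_def)
  define E where "E = {l. ?f l = N}"
  have "N \<in> range ?f" unfolding N_def by (rule Max_in) auto
  then have "E \<noteq> {}" by (auto simp: E_def)
  then have "Max ((\<lambda>l. norm (component A l)) ` E) \<in> (\<lambda>l. norm (component A l)) ` E"
    by (intro Max_in) auto
  then obtain i where i: "i \<in> E" "norm (component A i) = Max ((\<lambda>l. norm (component A l)) ` E)"
    by auto
  have longest: "norm (component A l) \<le> norm (component A i)" if "l \<in> E" for l
    unfolding i(2) using that by simp
  have "N > 0" using fN[of l] nonzero by linarith
  have fi: "?f i = N" using i(1) by (simp add: E_def)
  \<comment> \<open>Replacing \<open>\<gamma>\<close> by its negative if needed, it is positive at \<open>c\<close>.\<close>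
  define c where "c = component A i"
  define g where "g = sgn (\<gamma> \<bullet> c) *\<^sub>R \<gamma>"
  have gc: "g \<bullet> c = N"
    using fi by (simp add: g_def c_def mult.commute[of "sgn _"] flip: abs_sgn)
  have gl: "\<bar>g \<bullet> component A l\<bar> = ?f l" for l
    using gc \<open>N > 0\<close> by (auto simp: g_def abs_mult abs_sgn_eq)
  have cs: "\<bar>c \<bullet> d\<bar> < c \<bullet> c" if "norm d \<le> norm c" "d \<noteq> c" "d \<noteq> - c" for d
  proof -
    have "(norm (c - d))\<^sup>2 > 0" "(norm (c + d))\<^sup>2 > 0"
      using that by (auto simp: eq_neg_iff_add_eq_0 add.commute)
    moreover have "d \<bullet> d \<le> c \<bullet> c"
      using that(1) by (simp add: norm_le)
    ultimately show ?thesis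
      unfolding power2_norm_eq_inner by (auto simp: inner_diff inner_add inner_commute)
  qed
  have ex: "\<exists>K0. \<forall>K>K0. \<bar>(K *\<^sub>R g + c) \<bullet> component A l\<bar> < \<bar>(K *\<^sub>R g + c) \<bullet> c\<bar>"
    if l: "l \<notin> star_index A i" for l
  proof -
    let ?d = "component A l"
    have ne: "?d \<noteq> c" "?d \<noteq> - c" using l by (auto simp: star_index_iff c_def)
    have upper: "\<bar>(K *\<^sub>R g + c) \<bullet> ?d\<bar> \<le> K * ?f l + \<bar>c \<bullet> ?d\<bar>" if "K > 0" for K
      using abs_triangle_ineq[of "K * (g \<bullet> ?d)" "c \<bullet> ?d"] that gl[of l]
      by (simp add: inner_add_left abs_mult)
    have lower: "K * N + c \<bullet> c \<le> \<bar>(K *\<^sub>R g + c) \<bullet> c\<bar>" for K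
      using gc by (simp add: inner_add_left)
    show ?thesis
    proof (cases "l \<in> E")
      case True
      then have "\<bar>c \<bullet> ?d\<bar> < c \<bullet> c" using longest[OF True] ne by (intro cs) (auto simp: c_def)
      moreover have "?f l = N" using True by (simp add: E_def)
      ultimately show ?thesis using upper lower by (intro exI[of _ 0]) (smt (verit))
    next
      case False
      then have gap: "N - ?f l > 0" using fN[of l] by (simp add: E_def order.strict_iff_order)
      show ?thesis
      proof (intro exI[of _ "\<bar>c \<bullet> ?d\<bar> / (N - ?f l)"] allI impI)
        fix K assume K: "K > \<bar>c \<bullet> ?d\<bar> / (N - ?f l)"
        then have "\<bar>c \<bullet> ?d\<bar> < K * (N - ?f l)" using gap by (simp add: pos_divide_less_eq)
        moreover have "K > 0"
          using K gap by (smt (verit) divide_nonneg_pos)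
        ultimately show "\<bar>(K *\<^sub>R g + c) \<bullet> ?d\<bar> < \<bar>(K *\<^sub>R g + c) \<bullet> c\<bar>"
          using upper[of K] lower[of K] inner_ge_zero[of c]
          unfolding right_diff_distrib by linarith
      qed
    qed
  qed
  then obtain K0 where K0: "\<And>l K. \<lbrakk>l \<notin> star_index A i; K > K0 l\<rbrakk> \<Longrightarrow>
      \<bar>(K *\<^sub>R g + c) \<bullet> component A l\<bar> < \<bar>(K *\<^sub>R g + c) \<bullet> c\<bar>"
    by metis
  define K where "K = Max (range K0) + 1"
  have "K0 l < K" for l
    using Max_ge[OF finite_imageI[OF finite] rangeI, of K0 l] unfolding K_def by linarith
  with K0 have "star_property A i"
    unfolding star_property_iff_peak c_def[symmetric] by blast
  with fN fi that show ?thesis by auto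
qed

section \<open>Numerical ranges of star-associated matrices\<close>

text \<open>The sign changes in the rows of the star-associated matrix are moved to the vector.\<close>

definition reflect :: "('m::finite \<Rightarrow> real^'n^'n) \<Rightarrow> 'n \<Rightarrow> real^'n \<Rightarrow> real^'n" where
  "reflect A i x = (\<chi> l. if l \<in> P_plus A i then x $ l else - x $ l)"

definition supported_on :: "'n set \<Rightarrow> (real^'n) set" where
  "supported_on I = {x. \<forall>l. l \<notin> I \<longrightarrow> x $ l = 0}"

lemma subspace_supported_on: "subspace (supported_on I)"
  by (auto simp: subspace_def supported_on_def)

lemma linear_reflect: "linear (reflect A i)"
  by (rule linearI) (auto simp: reflect_def vec_eq_iff)

lemma norm_reflect: "norm (reflect A i x) = norm x"
  unfolding norm_vec_def by (rule L2_set_cong) (auto simp: reflect_def)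

lemma norm_eq_L2_set_support:
  assumes "x \<in> supported_on I"
  shows "norm x = L2_set (\<lambda>l. x $ l) I"
proof -
  have "norm x = sqrt (\<Sum>l\<in>UNIV. (x $ l)\<^sup>2)"
    by (simp add: norm_vec_def L2_set_def)
  also have "(\<Sum>l\<in>UNIV. (x $ l)\<^sup>2) = (\<Sum>l\<in>I. (x $ l)\<^sup>2)"
    using assms by (intro sum.mono_neutral_right) (auto simp: supported_on_def)
  finally show ?thesis by (simp add: L2_set_def)
qed

lemma star_associated_form:
  fixes A :: "'m::finite \<Rightarrow> real^'n^'n"
  assumes "x \<in> supported_on (star_index A i)"
  shows "(\<Sum>r\<in>star_index A i. (\<Sum>s\<in>star_index A i. star_associated A T i r s * x $ s) * x $ r) =
    (T *v x) \<bullet> reflect A i x"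
proof -
  let ?I = "star_index A i"
  have row: "(T *v x) $ r = (\<Sum>s\<in>?I. T $ r $ s * x $ s)" for r
    unfolding matrix_vector_mult_def vec_lambda_beta
    using assms by (intro sum.mono_neutral_right) (auto simp: supported_on_def)
  have "(T *v x) \<bullet> reflect A i x = (\<Sum>r\<in>?I. (T *v x) $ r * reflect A i x $ r)"
    unfolding inner_vec_def inner_real_def
    using assms by (intro sum.mono_neutral_right) (auto simp: supported_on_def reflect_def)
  also have "\<dots> = (\<Sum>r\<in>?I. (\<Sum>s\<in>?I. star_associated A T i r s * x $ s) * x $ r)"
    by (rule sum.cong)
       (auto simp: row reflect_def star_associated_def sum_negf)
  finally show ?thesis by simp
qed

lemma mem_numerical_range_star_associated_iff:
  fixes A :: "'m::finite \<Rightarrow> real^'n^'n"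
  shows "a \<in> numerical_range (star_index A i) (star_associated A T i) \<longleftrightarrow>
    (\<exists>x\<in>supported_on (star_index A i). norm x = 1 \<and> (T *v x) \<bullet> reflect A i x = a)"
proof
  let ?I = "star_index A i"
  assume "a \<in> numerical_range ?I (star_associated A T i)"
  then obtain f where f: "L2_set f ?I = 1"
    "a = (\<Sum>r\<in>?I. (\<Sum>s\<in>?I. star_associated A T i r s * f s) * f r)"
    by (auto simp: numerical_range_def)
  define x :: "real^'n" where "x = (\<chi> l. if l \<in> ?I then f l else 0)"
  have x: "x \<in> supported_on ?I" by (simp add: x_def supported_on_def)
  have "norm x = L2_set f ?I"
    unfolding norm_eq_L2_set_support[OF x] by (rule L2_set_cong) (auto simp: x_def)
  moreover have "(T *v x) \<bullet> reflect A i x = a"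
    unfolding star_associated_form[OF x, symmetric] f(2) by (simp add: x_def)
  ultimately show "\<exists>x\<in>supported_on ?I. norm x = 1 \<and> (T *v x) \<bullet> reflect A i x = a"
    using x f(1) by auto
next
  assume "\<exists>x\<in>supported_on (star_index A i). norm x = 1 \<and> (T *v x) \<bullet> reflect A i x = a"
  then obtain x where x: "x \<in> supported_on (star_index A i)" "norm x = 1"
    "(T *v x) \<bullet> reflect A i x = a" by blast
  show "a \<in> numerical_range (star_index A i) (star_associated A T i)"
    unfolding numerical_range_def
    using x norm_eq_L2_set_support[OF x(1)] star_associated_form[OF x(1), of T]
    by (auto intro!: exI[of _ "\<lambda>l. x $ l"])
qed

lemma combination_mult_supported:
  fixes A :: "'m::finite \<Rightarrow> real^'n^'n"
  assumes "\<And>k. A k \<in> diagonal_matrices" and x: "x \<in> supported_on (star_index A i)"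
  shows "combination A \<beta> *v x = (\<beta> \<bullet> component A i) *\<^sub>R reflect A i x"
proof -
  have "(\<beta> \<bullet> component A l) * x $ l = (\<beta> \<bullet> component A i) * reflect A i x $ l" for l
  proof (cases "l \<in> star_index A i")
    case True
    then show ?thesis by (auto simp: star_index_iff reflect_def P_plus_def)
  next
    case False
    then show ?thesis using x by (simp add: supported_on_def reflect_def)
  qed
  then show ?thesis by (simp add: vec_eq_iff combination_mult_vec_nth[OF assms(1)])
qed

text \<open>On the class of \<open>i\<close> the combination acts as a multiple of the reflection, so subtracting it
translates the form by a constant on unit vectors.\<close>

lemma mem_numerical_range_iff_residual:
  fixes A :: "'m::finite \<Rightarrow> real^'n^'n"
  assumes "\<And>k. A k \<in> diagonal_matrices"
  shows "\<alpha> \<bullet> component A i \<in> numerical_range (star_index A i) (star_associated A T i) \<longleftrightarrow>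
    (\<exists>x\<in>supported_on (star_index A i).
       norm x = 1 \<and> ((T - combination A \<alpha>) *v x) \<bullet> reflect A i x = 0)"
proof -
  have "((T - combination A \<alpha>) *v x) \<bullet> reflect A i x =
      (T *v x) \<bullet> reflect A i x - \<alpha> \<bullet> component A i"
    if "x \<in> supported_on (star_index A i)" "norm x = 1" for x
  proof -
    have "reflect A i x \<bullet> reflect A i x = 1"
      using that(2) by (simp add: norm_reflect flip: power2_norm_eq_inner)
    then show ?thesis
      by (simp add: matrix_vector_mult_diff_rdistrib inner_diff_left
          combination_mult_supported[OF assms that(1)])
  qed
  then show ?thesis unfolding mem_numerical_range_star_associated_iff by auto
qed

section \<open>Birkhoff-James orthogonality to the residual\<close>

text \<open>Pairing with the unit vectors \<open>x\<close> and \<open>reflect A i x\<close> kills the residual and reads off the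
diagonal entry at \<open>i\<close>.\<close>

lemma residual_zero_imp_matrix_opnorm_ge:
  fixes A :: "'m::finite \<Rightarrow> real^'n^'n"
  assumes "\<And>k. A k \<in> diagonal_matrices"
    and x: "x \<in> supported_on (star_index A i)" "norm x = 1" "(S *v x) \<bullet> reflect A i x = 0"
  shows "\<bar>\<gamma> \<bullet> component A i\<bar> \<le> matrix_opnorm (S + combination A \<gamma>)"
proof -
  have "reflect A i x \<bullet> reflect A i x = 1"
    using x(2) by (simp add: norm_reflect flip: power2_norm_eq_inner)
  then have "((S + combination A \<gamma>) *v x) \<bullet> reflect A i x = \<gamma> \<bullet> component A i"
    using x(3) by (simp add: matrix_vector_mult_add_rdistrib inner_add_left
        combination_mult_supported[OF assms(1) x(1)])
  then show ?thesis
    using matrix_opnorm_ge_inner[of x "reflect A i x" "S + combination A \<gamma>"] x(2)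
    by (simp add: norm_reflect)
qed

text \<open>A coordinate outside the class of the peak would be multiplied by a strictly smaller
factor, so that the norm could not be attained.\<close>

lemma norm_attained_at_peak_imp_supported:
  fixes A :: "'m::finite \<Rightarrow> real^'n^'n"
  assumes "\<And>k. A k \<in> diagonal_matrices"
    and peak: "\<And>l. l \<notin> star_index A i \<Longrightarrow> \<bar>\<beta> \<bullet> component A l\<bar> < \<bar>\<beta> \<bullet> component A i\<bar>"
    and x: "norm x = 1" "norm (combination A \<beta> *v x) = matrix_opnorm (combination A \<beta>)"
  shows "x \<in> supported_on (star_index A i)"
proof (rule ccontr)
  assume "x \<notin> supported_on (star_index A i)"
  then obtain l where l: "l \<notin> star_index A i" "x $ l \<noteq> 0"
    by (auto simp: supported_on_def)
  let ?b = "\<beta> \<bullet> component A i"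
  have le: "\<bar>\<beta> \<bullet> component A s\<bar> \<le> \<bar>?b\<bar>" for s
    using peak[of s] by (cases "s \<in> star_index A i") (auto simp: star_index_iff)
  have "(norm (combination A \<beta> *v x))\<^sup>2 = (\<Sum>s\<in>UNIV. (\<beta> \<bullet> component A s)\<^sup>2 * (x $ s)\<^sup>2)"
    unfolding norm_vec_def L2_set_def
    by (simp add: sum_nonneg combination_mult_vec_nth[OF assms(1)] abs_mult power_mult_distrib)
  also have "\<dots> < (\<Sum>s\<in>UNIV. ?b\<^sup>2 * (x $ s)\<^sup>2)"
  proof (rule sum_strict_mono_ex1)
    show "\<forall>s\<in>UNIV. (\<beta> \<bullet> component A s)\<^sup>2 * (x $ s)\<^sup>2 \<le> ?b\<^sup>2 * (x $ s)\<^sup>2"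
      using le by (auto intro!: mult_right_mono simp: abs_le_square_iff)
    have "(\<beta> \<bullet> component A l)\<^sup>2 < ?b\<^sup>2"
      using peak[OF l(1)] by (simp add: abs_le_square_iff flip: not_le)
    then show "\<exists>s\<in>UNIV. (\<beta> \<bullet> component A s)\<^sup>2 * (x $ s)\<^sup>2 < ?b\<^sup>2 * (x $ s)\<^sup>2"
      using l(2) by (intro bexI[of _ l]) auto
  qed simp
  also have "\<dots> = ?b\<^sup>2 * (norm x)\<^sup>2"
    by (simp add: norm_vec_def L2_set_def sum_nonneg sum_distrib_left)
  also have "\<dots> \<le> (matrix_opnorm (combination A \<beta>))\<^sup>2"
    using matrix_opnorm_combination_ge[where A = A and \<beta> = \<beta> and i = i, OF assms(1)] x(1)
    by (auto simp: power2_le_iff_abs_le)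
  finally show False using x(2) by simp
qed

lemma orthogonal_imp_residual_nonneg:
  fixes A :: "'m::finite \<Rightarrow> real^'n^'n"
  assumes diag: "\<And>k. A k \<in> diagonal_matrices"
    and peak: "\<And>l. l \<notin> star_index A i \<Longrightarrow> \<bar>\<beta> \<bullet> component A l\<bar> < \<bar>\<beta> \<bullet> component A i\<bar>"
    and orth: "\<And>\<gamma>. matrix_opnorm (combination A \<gamma>) \<le> matrix_opnorm (S + combination A \<gamma>)"
  obtains x where "x \<in> supported_on (star_index A i)" "norm x = 1"
    "(\<beta> \<bullet> component A i) * ((S *v x) \<bullet> reflect A i x) \<ge> 0"
proof -
  let ?B = "combination A \<beta>"
  have ray: "k * onorm ((*v) ?B) \<le> onorm (\<lambda>x. S *v x + k *\<^sub>R (?B *v x))" if "k > 0" for k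
  proof -
    have kB: "combination A (k *\<^sub>R \<beta>) *v x = k *\<^sub>R (?B *v x)" for x
      by (simp add: linear_scale[OF linear_combination] scaleR_matrix_vector_assoc)
    have "k * onorm ((*v) ?B) = onorm (\<lambda>x. k *\<^sub>R (?B *v x))"
      using that onorm_scaleR[OF matrix_vector_mul_bounded_linear[of ?B], of k] by simp
    also have "\<dots> = matrix_opnorm (combination A (k *\<^sub>R \<beta>))"
      unfolding matrix_opnorm_def kB ..
    also have "\<dots> \<le> matrix_opnorm (S + combination A (k *\<^sub>R \<beta>))" by (rule orth)
    also have "\<dots> = onorm (\<lambda>x. S *v x + k *\<^sub>R (?B *v x))"
      unfolding matrix_opnorm_def matrix_vector_mult_add_rdistrib kB ..
    finally show ?thesis .
  qed
  obtain x where x: "norm x = 1" "norm (?B *v x) = onorm ((*v) ?B)" "(S *v x) \<bullet> (?B *v x) \<ge> 0"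
    using onorm_ray_orthogonal_imp_inner_nonneg[OF matrix_vector_mul_bounded_linear[of S]
        matrix_vector_mul_bounded_linear[of ?B] ray] by blast
  have supp: "x \<in> supported_on (star_index A i)"
    using norm_attained_at_peak_imp_supported[OF diag peak x(1)] x(2)
    by (simp add: matrix_opnorm_def)
  then show ?thesis
    using that[of x] x by (simp add: combination_mult_supported[OF diag supp])
qed

text \<open>Both \<open>\<beta>\<close> and \<open>- \<beta>\<close> peak on the class of \<open>i\<close>; they give the residual form both signs.\<close>

lemma orthogonal_imp_residual_zero:
  fixes A :: "'m::finite \<Rightarrow> real^'n^'n"
  assumes diag: "\<And>k. A k \<in> diagonal_matrices" and ind: "linearly_independent_family A"
    and star: "star_property A i"
    and orth: "\<And>\<gamma>. matrix_opnorm (combination A \<gamma>) \<le> matrix_opnorm (S + combination A \<gamma>)"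
  shows "\<exists>x\<in>supported_on (star_index A i). norm x = 1 \<and> (S *v x) \<bullet> reflect A i x = 0"
proof -
  let ?V = "supported_on (star_index A i)" and ?q = "\<lambda>x. (S *v x) \<bullet> reflect A i x"
  obtain \<beta> where \<beta>: "\<beta> \<bullet> component A i \<noteq> 0"
    "\<And>l. l \<notin> star_index A i \<Longrightarrow> \<bar>\<beta> \<bullet> component A l\<bar> < \<bar>\<beta> \<bullet> component A i\<bar>"
    using star_property_nonzero_peak[OF diag ind star] by blast
  obtain x where x: "x \<in> ?V" "norm x = 1" "(\<beta> \<bullet> component A i) * ?q x \<ge> 0"
    using orthogonal_imp_residual_nonneg[OF diag \<beta>(2) orth] by blast
  obtain y where y: "y \<in> ?V" "norm y = 1" "(- \<beta> \<bullet> component A i) * ?q y \<ge> 0"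
    using orthogonal_imp_residual_nonneg[OF diag _ orth, of i "- \<beta>"] \<beta>(2) by auto
  have zero: "\<exists>z\<in>?V. norm z = 1 \<and> ?q z = 0"
    if "u \<in> ?V" "norm u = 1" "?q u \<ge> 0" "v \<in> ?V" "norm v = 1" "?q v \<le> 0" for u v
    using quadratic_form_zero_between[OF matrix_vector_mul_bounded_linear[of S]
        linear_conv_bounded_linear[THEN iffD1, OF linear_reflect[of A i]]
        subspace_supported_on that] by blast
  show ?thesis
  proof (cases "\<beta> \<bullet> component A i > 0")
    case True
    with x y show ?thesis
      by (intro zero[of x y]) (auto simp: zero_le_mult_iff mult_le_0_iff)
  next
    case False
    with \<beta>(1) x y show ?thesis
      by (intro zero[of y x]) (auto simp: zero_le_mult_iff mult_le_0_iff)
  qed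
qed

theorem theorem2p10:
  fixes A :: "'m::finite \<Rightarrow> real^'n^'n"
    and j :: "nat \<Rightarrow> 'n" and r :: nat
    and T :: "real^'n^'n" and \<alpha> :: "real^'m"
  assumes "\<And>k. A k \<in> diagonal_matrices"
    and "linearly_independent_family A"
    and "\<And>p. p \<in> {1..r} \<Longrightarrow> star_property A (j p)"
    and "\<And>p q. p \<in> {1..r} \<Longrightarrow> q \<in> {1..r} \<Longrightarrow> p \<noteq> q \<Longrightarrow>
           \<not> equivalent_components A (j p) (j q)"
    and "\<And>i. star_property A i \<Longrightarrow> \<exists>p\<in>{1..r}. equivalent_components A i (j p)"
  shows "best_coapproximation matrix_opnorm (span (range A)) T (\<Sum>k\<in>UNIV. \<alpha> $ k *\<^sub>R A k) \<longleftrightarrow>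
    (\<forall>p\<in>{1..r}.
      (\<Sum>k\<in>UNIV. A k $ j p $ j p * \<alpha> $ k)
        \<in> numerical_range (star_index A (j p)) (star_associated A T (j p)))"
proof -
  note diag = assms(1)
  let ?S = "T - combination A \<alpha>"
  let ?zero = "\<lambda>i. \<exists>x\<in>supported_on (star_index A i). norm x = 1 \<and> (?S *v x) \<bullet> reflect A i x = 0"
  have entry: "(\<Sum>k\<in>UNIV. A k $ i $ i * \<alpha> $ k) = \<alpha> \<bullet> component A i" for i
    by (simp add: inner_vec_def component_def mult.commute)
  have "(\<forall>\<gamma>. matrix_opnorm (combination A \<gamma>) \<le> matrix_opnorm (?S + combination A \<gamma>)) \<longleftrightarrow>
    (\<forall>p\<in>{1..r}. ?zero (j p))"
  proof (intro iffI ballI allI)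
    fix p
    assume orth: "\<forall>\<gamma>. matrix_opnorm (combination A \<gamma>) \<le> matrix_opnorm (?S + combination A \<gamma>)"
      and p: "p \<in> {1..r}"
    show "?zero (j p)"
      by (rule orthogonal_imp_residual_zero[OF diag assms(2) assms(3)[OF p]]) (use orth in blast)
  next
    fix \<gamma>
    assume zero: "\<forall>p\<in>{1..r}. ?zero (j p)"
    show "matrix_opnorm (combination A \<gamma>) \<le> matrix_opnorm (?S + combination A \<gamma>)"
    proof (cases "\<forall>l. \<gamma> \<bullet> component A l = 0")
      case True
      then have "matrix_opnorm (combination A \<gamma>) \<le> 0"
        by (intro matrix_opnorm_combination_le[OF diag]) simp
      also have "0 \<le> matrix_opnorm (?S + combination A \<gamma>)"
        by (simp add: matrix_opnorm_def onorm_pos_le)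
      finally show ?thesis .
    next
      case False
      then obtain i where i: "star_property A i"
        "\<And>l. \<bar>\<gamma> \<bullet> component A l\<bar> \<le> \<bar>\<gamma> \<bullet> component A i\<bar>"
        using star_property_attains_max[of \<gamma> A] by blast
      obtain p where p: "p \<in> {1..r}" "equivalent_components A i (j p)"
        using assms(5)[OF i(1)] by blast
      have eq: "\<bar>\<gamma> \<bullet> component A i\<bar> = \<bar>\<gamma> \<bullet> component A (j p)\<bar>"
        using p(2) by (auto simp: equivalent_components_def)
      have "matrix_opnorm (combination A \<gamma>) \<le> \<bar>\<gamma> \<bullet> component A (j p)\<bar>"
        using i(2) eq by (intro matrix_opnorm_combination_le[OF diag]) simp
      also have "\<dots> \<le> matrix_opnorm (?S + combination A \<gamma>)"
        using zero p(1) residual_zero_imp_matrix_opnorm_ge[where A = A, OF diag] by blast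
      finally show ?thesis .
    qed
  qed
  then show ?thesis
    unfolding entry mem_numerical_range_iff_residual[OF diag]
    unfolding combination_def[symmetric] best_coapproximation_combination_iff .
qed

end
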